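(* Let $(T,w,n,m)$ be an MWTM instance with tree $T$ on nodes $\{1,\dots,n\}$ rooted at $r$, $m>1$ tasks, and weights $w_{i,j}$ with $w_{r,j}=0$ for all $j$. Run the following Bottom-Up-Assignment (BOA) procedure. (1) Set $\alpha\leftarrow\emptyset$, $tasksLeft\leftarrow\{1..m\}$, $nodesLeft\leftarrow\{1..n\}$. (2) Solve the LP relaxation of the instance with the additional constraints $x_{i,j}=1$ for all $(i,j)\in\alpha$, obtaining a solution $x$. (3) Let $T'$ be obtained from $T$ by deleting all nodes $i$ with $(i,j)\in\alpha$ for some $j$ (a deleted node is removed together with its descendants). (4) Let $\lambda\leftarrow$ the set of leaves of $T'$. (5) While there exist $i\in\lambda\cap nodesLeft$ and $j\in tasksLeft$ with $x_{i,j}\neq 0$: choose such a pair maximizing $x_{i,j}$; add $(i,j)$ to $\alpha$; remove $i$ from $\lambda$ and from $nodesLeft$; remove $j$ from $tasksLeft$; remove from $nodesLeft$ every node other than $i$ on the path from $i$ to $r$ in $T'$; delete $i$ from $T'$. (6) If $tasksLeft\ne\emptyset$: delete all nodes of $\lambda$ from $T'$; let $leavesLeft=nodesLeft\cap\mathrm{leaves}(T')$ and $nodesLeftInT'=nodesLeft\cap\mathrm{nodes}(T')$. If some $i\in nodesLeftInT'$ has $x_{i,j}\ne 0$ for some $j\in tasksLeft$, and $|leavesLeft|\ge|tasksLeft|$, go to step (4); otherwise go to step (2). (7) Return $\alpha$. Then, whenever the MWTM instance admits a feasible assignment, BOA returns a feasible assignment.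
   Context: In an MWTM instance, a feasible assignment assigns all $m$ tasks to nodes of $T$ such that distinct tasks are assigned to distinct nodes and no assigned node is an ancestor of another assigned node. With $\lambda_T$ the set of leaves of $T$ and $\Pi_k$ the set of nodes on the path from the root to leaf $k$, the LP relaxation is: maximize $\sum_{i,j} w_{i,j}x_{i,j}$ subject to $\sum_{j} x_{i,j}\le 1$ for every node $i$; $\sum_{i} x_{i,j}=1$ for every task $j$; $\sum_{i\in\Pi_k}\sum_j x_{i,j}\le 1$ for every leaf $k\in\lambda_T$; and $0\le x_{i,j}\le1$. *)

theory Defs
  imports Complex_Main
begin

text \<open>Edges are directed from parent to child.  The record also holds the trees obtained by
  deleting nodes; these may have lost their root, and then they are empty.\<close>

record rtree =
  rt_root :: nat
  rt_nodes :: "nat set"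
  rt_edges :: "(nat \<times> nat) set"

definition rooted_tree :: "rtree \<Rightarrow> bool" where
  "rooted_tree T \<longleftrightarrow>
     finite (rt_nodes T) \<and>
     rt_root T \<in> rt_nodes T \<and>
     rt_edges T \<subseteq> rt_nodes T \<times> rt_nodes T \<and>
     (\<forall>u. (u, rt_root T) \<notin> rt_edges T) \<and>
     (\<forall>v \<in> rt_nodes T - {rt_root T}. \<exists>!u. (u, v) \<in> rt_edges T) \<and>
     (\<forall>v \<in> rt_nodes T. (rt_root T, v) \<in> (rt_edges T)\<^sup>*)"

definition leaves :: "rtree \<Rightarrow> nat set" where
  "leaves T = {v \<in> rt_nodes T. \<forall>u. (v, u) \<notin> rt_edges T}"

definition root_path :: "rtree \<Rightarrow> nat \<Rightarrow> nat set" where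
  "root_path T k =
     {v \<in> rt_nodes T. (rt_root T, v) \<in> (rt_edges T)\<^sup>* \<and> (v, k) \<in> (rt_edges T)\<^sup>*}"

text \<open>A deleted node is removed together with all its descendants.\<close>

definition delete_nodes :: "rtree \<Rightarrow> nat set \<Rightarrow> rtree" where
  "delete_nodes T D =
     (let S = rt_nodes T - (rt_edges T)\<^sup>* `` D
      in T\<lparr>rt_nodes := S, rt_edges := rt_edges T \<inter> S \<times> S\<rparr>)"

text \<open>An assignment is a set of pairs (node, task); the tasks are \<open>1, \<dots>, m\<close>.\<close>

definition feasible_assignment :: "rtree \<Rightarrow> nat \<Rightarrow> (nat \<times> nat) set \<Rightarrow> bool" where
  "feasible_assignment T m \<alpha> \<longleftrightarrow>
     \<alpha> \<subseteq> rt_nodes T \<times> {1..m} \<and>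
     (\<forall>j \<in> {1..m}. \<exists>!i. (i, j) \<in> \<alpha>) \<and>
     (\<forall>i j j'. (i, j) \<in> \<alpha> \<and> (i, j') \<in> \<alpha> \<longrightarrow> j = j') \<and>
     (\<forall>i j i' j'. (i, j) \<in> \<alpha> \<and> (i', j') \<in> \<alpha> \<longrightarrow> (i, i') \<notin> (rt_edges T)\<^sup>+)"

definition lp_feasible :: "rtree \<Rightarrow> nat \<Rightarrow> (nat \<Rightarrow> nat \<Rightarrow> real) \<Rightarrow> bool" where
  "lp_feasible T m x \<longleftrightarrow>
     (\<forall>i \<in> rt_nodes T. (\<Sum>j = 1..m. x i j) \<le> 1) \<and>
     (\<forall>j \<in> {1..m}. (\<Sum>i \<in> rt_nodes T. x i j) = 1) \<and>
     (\<forall>k \<in> leaves T. (\<Sum>i \<in> root_path T k. \<Sum>j = 1..m. x i j) \<le> 1) \<and>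
     (\<forall>i \<in> rt_nodes T. \<forall>j \<in> {1..m}. 0 \<le> x i j \<and> x i j \<le> 1)"

definition lp_value :: "rtree \<Rightarrow> (nat \<Rightarrow> nat \<Rightarrow> real) \<Rightarrow> nat \<Rightarrow> (nat \<Rightarrow> nat \<Rightarrow> real) \<Rightarrow> real" where
  "lp_value T w m x = (\<Sum>i \<in> rt_nodes T. \<Sum>j = 1..m. w i j * x i j)"

definition lp_feasible_fixing ::
    "rtree \<Rightarrow> nat \<Rightarrow> (nat \<times> nat) set \<Rightarrow> (nat \<Rightarrow> nat \<Rightarrow> real) \<Rightarrow> bool" where
  "lp_feasible_fixing T m \<alpha> x \<longleftrightarrow> lp_feasible T m x \<and> (\<forall>(i, j) \<in> \<alpha>. x i j = 1)"

definition lp_optimal_fixing ::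
    "rtree \<Rightarrow> (nat \<Rightarrow> nat \<Rightarrow> real) \<Rightarrow> nat \<Rightarrow> (nat \<times> nat) set \<Rightarrow> (nat \<Rightarrow> nat \<Rightarrow> real) \<Rightarrow> bool" where
  "lp_optimal_fixing T w m \<alpha> x \<longleftrightarrow>
     lp_feasible_fixing T m \<alpha> x \<and>
     (\<forall>y. lp_feasible_fixing T m \<alpha> y \<longrightarrow> lp_value T w m y \<le> lp_value T w m x)"

text \<open>
  Bottom-Up-Assignment as a nondeterministic transition system.  The constructor is the step about
  to be executed, its arguments are the program variables live at that point, in the order
  \<open>\<alpha>\<close>, \<open>tasksLeft\<close>, \<open>nodesLeft\<close>, \<open>x\<close>, \<open>T'\<close>, \<open>\<lambda>\<close>.  The nondeterminism is in the choice of the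
  optimal LP solution and in tie-breaking among the pairs maximising \<open>x i j\<close>.  If the linear
  program is infeasible, the state before the LP call has no successor.
\<close>

datatype boa_state =
    Solve_LP "(nat \<times> nat) set" "nat set" "nat set"
  | Build_Tree "(nat \<times> nat) set" "nat set" "nat set" "nat \<Rightarrow> nat \<Rightarrow> real"
  | Take_Leaves "(nat \<times> nat) set" "nat set" "nat set" "nat \<Rightarrow> nat \<Rightarrow> real" rtree
  | Assign_Loop "(nat \<times> nat) set" "nat set" "nat set" "nat \<Rightarrow> nat \<Rightarrow> real" rtree "nat set"
  | Branch "(nat \<times> nat) set" "nat set" "nat set" "nat \<Rightarrow> nat \<Rightarrow> real" rtree "nat set"
  | Return "(nat \<times> nat) set"

definition boa_init :: "nat \<Rightarrow> nat \<Rightarrow> boa_state" where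
  "boa_init n m = Solve_LP {} {1..m} {1..n}"

definition boa_continue ::
    "nat set \<Rightarrow> nat set \<Rightarrow> (nat \<Rightarrow> nat \<Rightarrow> real) \<Rightarrow> rtree \<Rightarrow> bool" where
  "boa_continue tasksLeft nodesLeft x T' \<longleftrightarrow>
     (\<exists>i \<in> nodesLeft \<inter> rt_nodes T'. \<exists>j \<in> tasksLeft. x i j \<noteq> 0) \<and>
     card (nodesLeft \<inter> leaves T') \<ge> card tasksLeft"

inductive boa_step ::
    "rtree \<Rightarrow> (nat \<Rightarrow> nat \<Rightarrow> real) \<Rightarrow> nat \<Rightarrow> boa_state \<Rightarrow> boa_state \<Rightarrow> bool"
  for T :: rtree and w :: "nat \<Rightarrow> nat \<Rightarrow> real" and m :: nat
where
  solve_lp: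
    "lp_optimal_fixing T w m \<alpha> x \<Longrightarrow>
     boa_step T w m (Solve_LP \<alpha> tasks nodes) (Build_Tree \<alpha> tasks nodes x)"
| build_tree:
    "boa_step T w m (Build_Tree \<alpha> tasks nodes x)
       (Take_Leaves \<alpha> tasks nodes x (delete_nodes T {i. \<exists>j. (i, j) \<in> \<alpha>}))"
| take_leaves:
    "boa_step T w m (Take_Leaves \<alpha> tasks nodes x T') (Assign_Loop \<alpha> tasks nodes x T' (leaves T'))"
| assign:
    "\<lbrakk>i \<in> L \<inter> nodes; j \<in> tasks; x i j \<noteq> 0;
      \<forall>i' \<in> L \<inter> nodes. \<forall>j' \<in> tasks. x i' j' \<noteq> 0 \<longrightarrow> x i' j' \<le> x i j\<rbrakk> \<Longrightarrow>
     boa_step T w m (Assign_Loop \<alpha> tasks nodes x T' L)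
       (Assign_Loop (insert (i, j) \<alpha>) (tasks - {j}) (nodes - {i} - (root_path T' i - {i})) x
          (delete_nodes T' {i}) (L - {i}))"
| leave_loop:
    "\<forall>i \<in> L \<inter> nodes. \<forall>j \<in> tasks. x i j = 0 \<Longrightarrow>
     boa_step T w m (Assign_Loop \<alpha> tasks nodes x T' L) (Branch \<alpha> tasks nodes x T' L)"
| finish:
    "tasks = {} \<Longrightarrow> boa_step T w m (Branch \<alpha> tasks nodes x T' L) (Return \<alpha>)"
| go_up:
    "\<lbrakk>tasks \<noteq> {}; boa_continue tasks nodes x (delete_nodes T' L)\<rbrakk> \<Longrightarrow>
     boa_step T w m (Branch \<alpha> tasks nodes x T' L) (Take_Leaves \<alpha> tasks nodes x (delete_nodes T' L))"
| resolve_lp: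
    "\<lbrakk>tasks \<noteq> {}; \<not> boa_continue tasks nodes x (delete_nodes T' L)\<rbrakk> \<Longrightarrow>
     boa_step T w m (Branch \<alpha> tasks nodes x T' L) (Solve_LP \<alpha> tasks nodes)"

end

theory Submission
  imports Defs "HOL-Analysis.Function_Topology"
begin

text \<open>
  The tree \<open>T'\<close> is always an ancestor-closed part of \<open>T\<close>, so its leaves form an antichain, and
  \<open>nodesLeft\<close> consists of the nodes that are neither assigned nor above an assigned node.  The
  number of leaves of \<open>T'\<close> still available never drops below the number of open tasks: an
  assignment lowers both by one, and before the linear program is solved again each available leaf
  of \<open>T'\<close> can be exchanged for a leaf of \<open>T\<close> below it.  So the partial assignment always extends to
  a feasible one, whose indicator is a point of the restricted linear program; an optimum exists by
  compactness.

  For termination, suppose that the solution \<open>x\<close> takes the value 1 on the whole current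
  assignment.  The path constraints then force the mass of the open tasks onto available nodes of
  \<open>T'\<close>, and comparing the total mass with the bound 1 per root-to-leaf path shows that enough leaves
  are left to continue upwards.  Hence the linear program is solved again only after the assignment
  has grown beyond its last solution.
\<close>

section \<open>Rooted trees and their ancestor-closed subtrees\<close>

text \<open>Deletions leave an ancestor-closed part of \<open>T\<close> with the induced edges. Its
  node set may be empty while the root stays recorded, so later facts use the edges of
  \<open>T\<close> instead of \<open>rooted_tree T'\<close>.\<close>

definition subtree :: "rtree \<Rightarrow> rtree \<Rightarrow> bool" where
  "subtree T T' \<longleftrightarrow>
     rt_root T' = rt_root T \<and> rt_nodes T' \<subseteq> rt_nodes T \<and>
     rt_edges T' = rt_edges T \<inter> rt_nodes T' \<times> rt_nodes T' \<and>
     (\<forall>u v. (u, v) \<in> rt_edges T \<and> v \<in> rt_nodes T' \<longrightarrow> u \<in> rt_nodes T')"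

lemma delete_nodes_simps:
  "rt_root (delete_nodes T D) = rt_root T"
  "rt_nodes (delete_nodes T D) = rt_nodes T - (rt_edges T)\<^sup>* `` D"
  "rt_edges (delete_nodes T D) = rt_edges T \<inter> rt_nodes (delete_nodes T D) \<times> rt_nodes (delete_nodes T D)"
  by (simp_all add: delete_nodes_def Let_def)

lemma delete_leaves_nodes:
  assumes "L \<subseteq> leaves T"
  shows "rt_nodes (delete_nodes T L) = rt_nodes T - L"
proof -
  have "v = u" if "(u, v) \<in> (rt_edges T)\<^sup>*" "u \<in> L" for u v
    using that assms by (auto simp: leaves_def elim: converse_rtranclE)
  then show ?thesis by (auto simp: delete_nodes_simps)
qed

lemma leaves_not_ancestor:
  assumes "(u, v) \<in> (rt_edges T)\<^sup>*" "u \<in> leaves T"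
  shows "u = v"
  using assms by (auto simp: leaves_def elim: converse_rtranclE)

locale tree =
  fixes T :: rtree
  assumes rooted: "rooted_tree T"
begin

abbreviation "N \<equiv> rt_nodes T"
abbreviation "E \<equiv> rt_edges T"

lemma finite_N [simp]: "finite N"
  and E_subset: "E \<subseteq> N \<times> N"
  and no_edge_into_root: "(u, rt_root T) \<notin> E"
  and reachable: "v \<in> N \<Longrightarrow> (rt_root T, v) \<in> E\<^sup>*"
  using rooted by (auto simp: rooted_tree_def)

lemma parent_unique: "(u, v) \<in> E \<Longrightarrow> (u', v) \<in> E \<Longrightarrow> u = u'"
  using rooted E_subset no_edge_into_root unfolding rooted_tree_def by blast

lemma rtrancl_in_N: "(u, v) \<in> E\<^sup>* \<Longrightarrow> u \<in> N \<longleftrightarrow> v \<in> N"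
  by (induction rule: rtrancl_induct) (use E_subset in auto)

text \<open>A cycle through \<open>v\<close> enters \<open>v\<close> from its only parent, so it
  yields a cycle through that parent. Going up reaches the root, which no edge enters.\<close>

lemma acyclic_E: "acyclic E"
proof -
  have "(v, v) \<notin> E\<^sup>+" if "(rt_root T, v) \<in> E\<^sup>*" for v
    using that
  proof (induction rule: rtrancl_induct)
    case base
    then show ?case using no_edge_into_root by (meson tranclE)
  next
    case (step u v)
    have "(u, u) \<in> E\<^sup>+" if "(v, v) \<in> E\<^sup>+"
      using that step.hyps(2) parent_unique
      by (metis rtrancl_into_trancl2 tranclD2)
    then show ?case using step.IH by blast
  qed
  moreover have "v \<in> N" if "(v, v) \<in> E\<^sup>+" for v
    using that E_subset by (auto elim: tranclE)
  ultimately show ?thesis using reachable by (auto simp: acyclic_def)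
qed

text \<open>Unique parents make the converse edge relation single-valued, so of two walks up from
  \<open>k\<close> one continues the other.\<close>

lemma ancestors_comparable:
  assumes "(u, k) \<in> E\<^sup>*" "(v, k) \<in> E\<^sup>*"
  shows "(u, v) \<in> E\<^sup>* \<or> (v, u) \<in> E\<^sup>*"
proof -
  have "single_valued (E\<inverse>)"
    using parent_unique by (auto simp: single_valued_def)
  from single_valued_confluent[OF this, of k u v] assms show ?thesis
    by (auto simp: rtrancl_converse)
qed

lemma wf_converse_E: "wf (E\<inverse>)"
  using acyclic_E E_subset finite_N
  by (meson finite_SigmaI finite_acyclic_wf_converse finite_subset)

lemma subtree_refl: "subtree T T"
  using E_subset by (auto simp: subtree_def)

text \<open>The removed set is closed under descendants within \<open>T'\<close>, so what remains is
  closed under parents.\<close>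

lemma subtree_delete_nodes:
  assumes "subtree T T'"
  shows "subtree T (delete_nodes T' D)"
proof -
  have "u \<notin> (rt_edges T')\<^sup>* `` D"
    if "(u, v) \<in> rt_edges T'" "v \<notin> (rt_edges T')\<^sup>* `` D" for u v
    using that by (auto intro: rtrancl_into_rtrancl)
  then show ?thesis
    using assms unfolding subtree_def delete_nodes_simps by blast
qed

lemma subtree_ancestor:
  assumes "subtree T T'" "(u, v) \<in> E\<^sup>*" "v \<in> rt_nodes T'"
  shows "u \<in> rt_nodes T' \<and> (u, v) \<in> (rt_edges T')\<^sup>*"
  using assms(2,3)
proof (induction rule: converse_rtrancl_induct)
  case base
  then show ?case by simp
next
  case (step u w)
  then show ?case using assms(1) unfolding subtree_def
    by (metis IntI SigmaI converse_rtrancl_into_rtrancl)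
qed

lemma subtree_rtrancl: "subtree T T' \<Longrightarrow> (u, v) \<in> (rt_edges T')\<^sup>* \<Longrightarrow> (u, v) \<in> E\<^sup>*"
  by (metis inf_le1 rtrancl_mono subsetD subtree_def)

text \<open>An ancestor-closed tree contains the whole way up from \<open>k\<close>. Hence the path
  struck out in the loop and the path of an LP constraint are both sets of ancestors in
  \<open>T\<close>.\<close>

lemma root_path_subtree:
  assumes "subtree T T'" "k \<in> rt_nodes T'"
  shows "root_path T' k = {v. (v, k) \<in> E\<^sup>*}"
proof -
  have "v \<in> rt_nodes T' \<and> (rt_root T', v) \<in> (rt_edges T')\<^sup>* \<and> (v, k) \<in> (rt_edges T')\<^sup>*"
    if "(v, k) \<in> E\<^sup>*" for v
  proof -
    have v: "v \<in> rt_nodes T'" "(v, k) \<in> (rt_edges T')\<^sup>*"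
      using subtree_ancestor[OF assms(1) that assms(2)] by auto
    have "(rt_root T, v) \<in> E\<^sup>*" using reachable v(1) assms(1) by (auto simp: subtree_def)
    then show ?thesis
      using v subtree_ancestor[OF assms(1) _ v(1)] assms(1) by (auto simp: subtree_def)
  qed
  then show ?thesis
    using subtree_rtrancl[OF assms(1)] by (auto simp: root_path_def)
qed

lemmas root_path_eq = root_path_subtree[OF subtree_refl]

lemma leaf_below:
  assumes "subtree T T'" "v \<in> rt_nodes T'"
  shows "\<exists>l \<in> leaves T'. (v, l) \<in> E\<^sup>*"
  using assms(2)
proof (induction v rule: wf_induct_rule[OF wf_converse_E])
  case (1 v)
  show ?case
  proof (cases "v \<in> leaves T'")
    case False
    then obtain u where "(v, u) \<in> rt_edges T'" using 1(2) by (auto simp: leaves_def)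
    then have "(v, u) \<in> E" "u \<in> rt_nodes T'" using assms(1) by (auto simp: subtree_def)
    then show ?thesis using 1(1) by (meson converseI converse_rtrancl_into_rtrancl)
  qed auto
qed

lemma subtree_leaves_antichain:
  assumes "subtree T T'" "(u, v) \<in> E\<^sup>*" "u \<in> leaves T'" "v \<in> rt_nodes T'"
  shows "u = v"
  using subtree_ancestor[OF assms(1,2,4)] leaves_not_ancestor[of u v T'] assms(3) by blast

section \<open>The linear program\<close>

text \<open>The way to \<open>v\<close> is an initial part of the way to some leaf of
  \<open>T\<close>, and the remaining mass is nonnegative. This carries the constraint over to inner
  nodes of \<open>T\<close>, which may be leaves of \<open>T'\<close>.\<close>

lemma path_sum_le_1:
  assumes "lp_feasible T m x" "v \<in> N"
  shows "(\<Sum>i | (i, v) \<in> E\<^sup>*. \<Sum>j = 1..m. x i j) \<le> 1"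
proof -
  obtain l where l: "l \<in> leaves T" "(v, l) \<in> E\<^sup>*"
    using leaf_below[OF subtree_refl assms(2)] by blast
  have lN: "l \<in> N" using l by (simp add: leaves_def)
  have sub: "{i. (i, l) \<in> E\<^sup>*} \<subseteq> N" using lN rtrancl_in_N by auto
  have "(\<Sum>i | (i, v) \<in> E\<^sup>*. \<Sum>j = 1..m. x i j) \<le> (\<Sum>i | (i, l) \<in> E\<^sup>*. \<Sum>j = 1..m. x i j)"
  proof (rule sum_mono2)
    show "finite {i. (i, l) \<in> E\<^sup>*}" using sub finite_N by (rule finite_subset)
    show "{i. (i, v) \<in> E\<^sup>*} \<subseteq> {i. (i, l) \<in> E\<^sup>*}" using l(2) by auto
    show "0 \<le> (\<Sum>j = 1..m. x i j)" if "i \<in> {i. (i, l) \<in> E\<^sup>*} - {i. (i, v) \<in> E\<^sup>*}" for i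
      using that sub assms(1) by (intro sum_nonneg) (auto simp: lp_feasible_def)
  qed
  also have "\<dots> \<le> 1"
    using assms(1) l(1) root_path_eq[OF lN] by (auto simp: lp_feasible_def)
  finally show ?thesis .
qed

text \<open>Comparable nodes lie on the root path of the lower one, and the entry 1 already uses up
  the mass allowed there.\<close>

lemma zero_if_comparable_to_one:
  assumes lp: "lp_feasible T m x" and a: "a \<in> N" "j \<in> {1..m}" "x a j = 1"
    and i: "i \<in> N" "j' \<in> {1..m}" and ne: "(i, j') \<noteq> (a, j)"
    and cmp: "(a, i) \<in> E\<^sup>* \<or> (i, a) \<in> E\<^sup>*"
  shows "x i j' = 0"
proof -
  obtain v where v: "v \<in> N" "(i, v) \<in> E\<^sup>*" "(a, v) \<in> E\<^sup>*"
    using cmp a(1) i(1) by blast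
  let ?P = "{i. (i, v) \<in> E\<^sup>*}"
  have sub: "?P \<subseteq> N" using v(1) rtrancl_in_N by auto
  have fin: "finite ?P" using sub finite_N by (rule finite_subset)
  have nonneg: "0 \<le> x i j" if "i \<in> N" "j \<in> {1..m}" for i j
    using lp that by (auto simp: lp_feasible_def)
  \<comment> \<open>Summing over index pairs instead of nodes also covers \<open>i = a\<close> with
    two different tasks.\<close>
  have "(\<Sum>(i, j) \<in> {(a, j), (i, j')}. x i j) \<le> (\<Sum>(i, j) \<in> ?P \<times> {1..m}. x i j)"
    by (rule sum_mono2) (use fin sub v a i nonneg in auto)
  also have "\<dots> = (\<Sum>i \<in> ?P. \<Sum>j = 1..m. x i j)"
    by (simp add: sum.cartesian_product)
  also have "\<dots> \<le> 1" by (rule path_sum_le_1[OF lp v(1)])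
  finally have "x a j + x i j' \<le> 1" using ne by auto
  then show ?thesis using nonneg[OF i] a(3) by auto
qed

lemma lp_feasible_of_assignment:
  assumes "feasible_assignment T m \<beta>"
  shows "lp_feasible_fixing T m \<beta> (\<lambda>i j. of_bool ((i, j) \<in> \<beta>))"
proof -
  have sub: "\<beta> \<subseteq> N \<times> {1..m}" using assms by (simp add: feasible_assignment_def)
  \<comment> \<open>A node carries at most one task, so its row sum is the indicator of being used.
    A path constraint then counts the used nodes on a path: these are comparable, and the antichain
    condition allows only one.\<close>
  have row: "(\<Sum>j = 1..m. of_bool ((i, j) \<in> \<beta>)) = (of_bool (i \<in> Domain \<beta>) :: real)" for i
  proof (cases "i \<in> Domain \<beta>")
    case True
    then obtain j where "(i, j) \<in> \<beta>" by auto
    then have "(i, j') \<in> \<beta> \<longleftrightarrow> j' = j" for j'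
      using assms by (auto simp: feasible_assignment_def)
    then show ?thesis using True \<open>(i, j) \<in> \<beta>\<close> sub by (auto simp: of_bool_def)
  next
    case False
    then show ?thesis by (auto intro: sum.neutral)
  qed
  have col: "(\<Sum>i \<in> N. of_bool ((i, j) \<in> \<beta>)) = (1 :: real)" if "j \<in> {1..m}" for j
  proof -
    have "\<exists>!i. (i, j) \<in> \<beta>"
      using assms \<open>j \<in> {1..m}\<close> by (simp add: feasible_assignment_def)
    then obtain i where "(i, j) \<in> \<beta>" "\<And>i'. (i', j) \<in> \<beta> \<Longrightarrow> i' = i" by blast
    then have "(i', j) \<in> \<beta> \<longleftrightarrow> i' = i" for i' by blast
    then show ?thesis using \<open>(i, j) \<in> \<beta>\<close> sub by (auto simp: of_bool_def)
  qed
  have path: "(\<Sum>i \<in> root_path T k. of_bool (i \<in> Domain \<beta>)) \<le> (1 :: real)" if "k \<in> leaves T" for k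
  proof -
    have kN: "k \<in> N" using that by (simp add: leaves_def)
    have fin: "finite (root_path T k)"
      by (rule finite_subset[OF _ finite_N]) (auto simp: root_path_def)
    have "i = i'" if "i \<in> root_path T k \<inter> Domain \<beta>" "i' \<in> root_path T k \<inter> Domain \<beta>" for i i'
    proof -
      have "(i, i') \<in> E\<^sup>* \<or> (i', i) \<in> E\<^sup>*"
        using that ancestors_comparable root_path_eq[OF kN] by auto
      moreover have "(i, i') \<notin> E\<^sup>+" "(i', i) \<notin> E\<^sup>+"
        using that assms unfolding feasible_assignment_def by blast+
      ultimately show ?thesis by (auto simp: rtrancl_eq_or_trancl)
    qed
    then have "card (root_path T k \<inter> Domain \<beta>) \<le> 1"
      using fin by (simp add: card_le_Suc0_iff_eq)
    moreover have "(\<Sum>i \<in> root_path T k. of_bool (i \<in> Domain \<beta>)) = real (card (root_path T k \<inter> Domain \<beta>))"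
      using fin by (simp add: of_bool_def sum.If_cases)
    ultimately show ?thesis by simp
  qed
  show ?thesis
    unfolding lp_feasible_fixing_def lp_feasible_def row
    using col path by auto
qed

section \<open>Existence of an optimal LP solution\<close>

lemma continuous_coord: "continuous_on S (\<lambda>x :: nat \<Rightarrow> nat \<Rightarrow> real. x i j)"
proof -
  have "continuous_on UNIV (\<lambda>x :: nat \<Rightarrow> nat \<Rightarrow> real. x i)"
    by simp
  then have "continuous_on UNIV (\<lambda>x :: nat \<Rightarrow> nat \<Rightarrow> real. x i j)"
    by (rule continuous_on_product_then_coordinatewise)
  then show ?thesis by (rule continuous_on_subset) simp
qed

lemma closed_lp_feasible_fixing: "closed {x. lp_feasible_fixing T m \<alpha> x}"
proof -
  have le: "closed {x. f x \<le> g x}" and eq: "closed {x. f x = g x}"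
    if "continuous_on UNIV f" "continuous_on UNIV g" for f g :: "(nat \<Rightarrow> nat \<Rightarrow> real) \<Rightarrow> real"
    using that by (auto intro: closed_Collect_le closed_Collect_eq)
  \<comment> \<open>Unfolding bounded quantifiers gives premises independent of \<open>x\<close>; a
    false premise leaves the whole space.\<close>
  have imp: "closed {x. P \<longrightarrow> Q x}" if "closed {x :: nat \<Rightarrow> nat \<Rightarrow> real. Q x}" for P Q
    using that by (cases P) auto
  show ?thesis
    unfolding lp_feasible_fixing_def lp_feasible_def Ball_def case_prod_beta
    by (intro closed_Collect_conj closed_Collect_all imp le eq continuous_intros continuous_coord)
qed

text \<open>Entries outside \<open>N \<times> {1..m}\<close> are unconstrained, so the feasible set
  itself is not compact. Setting them to 0 preserves feasibility and value, so a maximum over the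
  truncated solutions is a maximum over all.\<close>

lemma lp_optimum_exists:
  assumes "lp_feasible_fixing T m \<alpha> y" "\<alpha> \<subseteq> N \<times> {1..m}"
  shows "\<exists>x. lp_optimal_fixing T w m \<alpha> x"
proof -
  define K :: "nat \<Rightarrow> nat \<Rightarrow> real set"
    where "K i j = (if i \<in> N \<and> j \<in> {1..m} then {0..1} else {0})" for i j
  define B where "B = PiE UNIV (\<lambda>i. PiE UNIV (K i))"
  define trunc :: "(nat \<Rightarrow> nat \<Rightarrow> real) \<Rightarrow> nat \<Rightarrow> nat \<Rightarrow> real"
    where "trunc x i j = (if i \<in> N \<and> j \<in> {1..m} then x i j else 0)" for x i j
  have "compact (K i j)" for i j by (simp add: K_def)
  \<comment> \<open>Tychonoff's theorem, applied once per index.\<close>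
  then have "compact B"
    unfolding B_def
    by (simp add: compactin_PiE flip: compactin_euclidean_iff euclidean_product_topology)
  then have comp: "compact (B \<inter> {x. lp_feasible_fixing T m \<alpha> x})"
    using closed_lp_feasible_fixing by (rule compact_Int_closed)
  have trunc: "lp_value T w m (trunc x) = lp_value T w m x"
    "lp_feasible_fixing T m \<alpha> x \<Longrightarrow> trunc x \<in> B \<inter> {x. lp_feasible_fixing T m \<alpha> x}" for x
  proof -
    have tr: "trunc x i j = x i j" if "i \<in> N" "j \<in> {1..m}" for i j
      using that by (simp add: trunc_def)
    have rp: "root_path T k \<subseteq> N" for k by (auto simp: root_path_def)
    show "lp_value T w m (trunc x) = lp_value T w m x"
      by (simp add: lp_value_def tr)
    assume "lp_feasible_fixing T m \<alpha> x"
    then have x: "lp_feasible T m x" "\<forall>(i, j) \<in> \<alpha>. x i j = 1"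
      by (auto simp: lp_feasible_fixing_def)
    have "(\<Sum>i \<in> root_path T k. \<Sum>j = 1..m. trunc x i j) = (\<Sum>i \<in> root_path T k. \<Sum>j = 1..m. x i j)" for k
      using rp tr by (intro sum.cong refl) auto
    then have "lp_feasible T m (trunc x)"
      using x(1) by (simp add: lp_feasible_def tr)
    moreover have "\<forall>(i, j) \<in> \<alpha>. trunc x i j = 1"
      using x(2) assms(2) tr by fastforce
    moreover have "trunc x \<in> B"
      using x(1) by (auto simp: B_def K_def trunc_def lp_feasible_def)
    ultimately show "trunc x \<in> B \<inter> {x. lp_feasible_fixing T m \<alpha> x}"
      by (simp add: lp_feasible_fixing_def)
  qed
  have "continuous_on (B \<inter> {x. lp_feasible_fixing T m \<alpha> x}) (lp_value T w m)"
    unfolding lp_value_def by (intro continuous_intros continuous_coord)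
  from continuous_attains_sup[OF comp _ this] trunc(2)[OF assms(1)]
  obtain x where x: "lp_feasible_fixing T m \<alpha> x"
    "\<And>z. z \<in> B \<inter> {x. lp_feasible_fixing T m \<alpha> x} \<Longrightarrow> lp_value T w m z \<le> lp_value T w m x"
    by blast
  then show ?thesis
    unfolding lp_optimal_fixing_def using trunc by metis
qed


section \<open>Partial assignments\<close>

text \<open>The other two program variables are functions of \<open>\<alpha>\<close>. Here
  \<open>nodes\<close> loses only used nodes and their ancestors; descendants of used nodes remain
  in it and are kept out by \<open>T'\<close>.\<close>

definition partial_assignment :: "nat \<Rightarrow> (nat \<times> nat) set \<Rightarrow> nat set \<Rightarrow> nat set \<Rightarrow> bool" where
  "partial_assignment m \<alpha> tasks nodes \<longleftrightarrow>
     \<alpha> \<subseteq> N \<times> {1..m} \<and> tasks = {1..m} - Range \<alpha> \<and>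
     nodes = N - {v. \<exists>a \<in> Domain \<alpha>. (v, a) \<in> E\<^sup>*} \<and>
     single_valued \<alpha> \<and> single_valued (\<alpha>\<inverse>) \<and>
     (\<forall>a \<in> Domain \<alpha>. \<forall>a' \<in> Domain \<alpha>. (a, a') \<notin> E\<^sup>+)"

lemma partial_assignment_empty: "partial_assignment m {} {1..m} N"
  by (simp add: partial_assignment_def)

lemma partial_assignment_finite:
  assumes "partial_assignment m \<alpha> tasks nodes"
  shows "finite tasks" "finite nodes" "tasks \<subseteq> {1..m}" "nodes \<subseteq> N"
  using assms by (auto simp: partial_assignment_def)

lemma partial_assignmentD:
  assumes "partial_assignment m \<alpha> tasks nodes"
  shows "\<alpha> \<subseteq> N \<times> {1..m}" "tasks = {1..m} - Range \<alpha>"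
    and "nodes = N - {v. \<exists>a \<in> Domain \<alpha>. (v, a) \<in> E\<^sup>*}"
    and "(i, j) \<in> \<alpha> \<Longrightarrow> (i', j) \<in> \<alpha> \<Longrightarrow> i = i'"
    and "(i, j) \<in> \<alpha> \<Longrightarrow> (i, j') \<in> \<alpha> \<Longrightarrow> j = j'"
    and "a \<in> Domain \<alpha> \<Longrightarrow> a' \<in> Domain \<alpha> \<Longrightarrow> (a, a') \<notin> E\<^sup>+"
  using assms unfolding partial_assignment_def by (simp_all add: single_valued_def)

lemma partial_assignment_complete:
  assumes "partial_assignment m \<alpha> {} nodes"
  shows "feasible_assignment T m \<alpha>"
proof -
  have "{1..m} \<subseteq> Range \<alpha>" using assms by (auto simp: partial_assignment_def)
  then have "\<exists>!i. (i, j) \<in> \<alpha>" if "j \<in> {1..m}" for j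
    using that partial_assignmentD(4)[OF assms] by blast
  moreover have "(i, i') \<notin> E\<^sup>+" if "(i, j) \<in> \<alpha>" "(i', j') \<in> \<alpha>" for i j i' j'
    using that partial_assignmentD(6)[OF assms] by blast
  ultimately show ?thesis
    using partial_assignmentD(1)[OF assms] partial_assignmentD(5)[OF assms]
    by (auto simp: feasible_assignment_def)
qed

text \<open>Membership in \<open>nodes\<close> keeps \<open>i\<close> from lying above a used node.
  It lies below none either, since \<open>T'\<close> would then contain that used node.\<close>

lemma partial_assignment_insert:
  assumes pa: "partial_assignment m \<alpha> tasks nodes"
    and sub: "subtree T T'" "rt_nodes T' \<inter> Domain \<alpha> = {}"
    and i: "i \<in> nodes" "i \<in> rt_nodes T'" and j: "j \<in> tasks"
  shows "partial_assignment m (insert (i, j) \<alpha>) (tasks - {j}) (nodes - {i} - (root_path T' i - {i}))"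
proof -
  have notbelow: "(a, i) \<notin> E\<^sup>+" if "a \<in> Domain \<alpha>" for a
    using that sub subtree_ancestor[OF sub(1) _ i(2)] trancl_into_rtrancl by (metis IntI empty_iff)
  have notabove: "(i, a) \<notin> E\<^sup>+" if "a \<in> Domain \<alpha>" for a
    using that i(1) partial_assignmentD(3)[OF pa] by (auto dest: trancl_into_rtrancl)
  have "i \<notin> Domain \<alpha>" using sub(2) i(2) by blast
  moreover have "j \<notin> Range \<alpha>" "j \<in> {1..m}" "i \<in> N"
    using j i(1) pa by (auto simp: partial_assignment_def)
  moreover have "(i, i) \<notin> E\<^sup>+" using acyclic_E by (simp add: acyclic_def)
  moreover have "nodes - {i} - (root_path T' i - {i}) = N - {v. \<exists>a \<in> Domain (insert (i, j) \<alpha>). (v, a) \<in> E\<^sup>*}"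
    using pa unfolding root_path_subtree[OF sub(1) i(2)] by (auto simp: partial_assignment_def)
  ultimately show ?thesis
    using pa notbelow notabove unfolding partial_assignment_def by (auto simp: single_valued_def)
qed

text \<open>Exchange argument: send each \<open>v\<close> in \<open>B\<close> to a leaf of
  \<open>T\<close> below it. Two nodes sharing a leaf would be comparable, so the map is
  injective.\<close>

lemma antichain_card_le_leaves:
  assumes pa: "partial_assignment m \<alpha> tasks nodes"
    and B: "B \<subseteq> nodes" "\<And>u v. u \<in> B \<Longrightarrow> v \<in> B \<Longrightarrow> (u, v) \<in> E\<^sup>* \<Longrightarrow> u = v"
    and below: "\<And>a v. a \<in> Domain \<alpha> \<Longrightarrow> v \<in> B \<Longrightarrow> (a, v) \<notin> E\<^sup>*"
  shows "card B \<le> card (nodes \<inter> leaves (delete_nodes T (Domain \<alpha>)))"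
proof -
  let ?R = "nodes \<inter> leaves (delete_nodes T (Domain \<alpha>))"
  have nodes: "nodes = N - {v. \<exists>a \<in> Domain \<alpha>. (v, a) \<in> E\<^sup>*}"
    using pa by (simp add: partial_assignment_def)
  have "\<exists>l. l \<in> leaves T \<and> (v, l) \<in> E\<^sup>*" if "v \<in> B" for v
    using leaf_below[OF subtree_refl, of v] that B(1) nodes by blast
  then obtain f where f: "\<And>v. v \<in> B \<Longrightarrow> f v \<in> leaves T" "\<And>v. v \<in> B \<Longrightarrow> (v, f v) \<in> E\<^sup>*"
    by metis
  have "inj_on f B"
    using f B(2) ancestors_comparable by (metis inj_onI)
  \<comment> \<open>If \<open>f v\<close> were above a used node, so would be \<open>v\<close>; if
    it were below one, that node would be comparable to \<open>v\<close>.\<close>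
  moreover have "f ` B \<subseteq> ?R"
  proof (rule image_subsetI)
    fix v assume v: "v \<in> B"
    have fN: "f v \<in> N" using f(1)[OF v] by (simp add: leaves_def)
    have nab: "(v, a) \<notin> E\<^sup>*" if "a \<in> Domain \<alpha>" for a
      using that v B(1) nodes by auto
    have "(f v, a) \<notin> E\<^sup>*" if "a \<in> Domain \<alpha>" for a
      using that nab f(2)[OF v] by (meson rtrancl_trans)
    then have "f v \<in> nodes" using fN nodes by auto
    moreover have "(a, f v) \<notin> E\<^sup>*" if "a \<in> Domain \<alpha>" for a
      using that nab below v f(2)[OF v] ancestors_comparable by blast
    ultimately show "f v \<in> ?R"
      using fN f(1)[OF v] by (auto simp: leaves_def delete_nodes_simps)
  qed
  moreover have "finite ?R" using partial_assignment_finite[OF pa] by simp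
  ultimately show ?thesis by (metis card_image card_mono)
qed

text \<open>Distinct available leaves of the fresh tree receive the open tasks. They form an
  antichain, lie below no used node by the deletion, and above none by the choice of
  \<open>nodes\<close>.\<close>

lemma partial_assignment_extends:
  assumes pa: "partial_assignment m \<alpha> tasks nodes"
    and card: "card tasks \<le> card (nodes \<inter> leaves (delete_nodes T (Domain \<alpha>)))"
  shows "\<exists>\<beta>. \<alpha> \<subseteq> \<beta> \<and> feasible_assignment T m \<beta>"
proof -
  let ?T = "delete_nodes T (Domain \<alpha>)" and ?R = "nodes \<inter> leaves (delete_nodes T (Domain \<alpha>))"
  have fin: "finite tasks" "finite ?R" using partial_assignment_finite[OF pa] by auto
  obtain g where g: "g ` tasks \<subseteq> ?R" "inj_on g tasks"
    using card_le_inj[OF fin card] by blast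
  let ?\<beta> = "\<alpha> \<union> {(g j, j) | j. j \<in> tasks}"
  have sub: "subtree T ?T" by (rule subtree_delete_nodes[OF subtree_refl])
  have R: "v \<in> N" "v \<in> rt_nodes ?T" if "v \<in> ?R" for v
    using that by (auto simp: leaves_def delete_nodes_simps)
  have acyc: "(v, v) \<notin> E\<^sup>+" for v using acyclic_E by (simp add: acyclic_def)
  have RR: "(u, v) \<notin> E\<^sup>+" if "u \<in> ?R" "v \<in> ?R" for u v
  proof
    assume uv: "(u, v) \<in> E\<^sup>+"
    then have "u = v"
      using that R(2) subtree_leaves_antichain[OF sub trancl_into_rtrancl] by blast
    then show False using uv acyc by blast
  qed
  have AR: "(a, v) \<notin> E\<^sup>*" if "a \<in> Domain \<alpha>" "v \<in> ?R" for a v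
    using that R(2)[of v] by (auto simp: delete_nodes_simps)
  have RA: "(v, a) \<notin> E\<^sup>*" if "a \<in> Domain \<alpha>" "v \<in> ?R" for a v
    using that pa by (auto simp: partial_assignment_def)
  have disj: "?R \<inter> Domain \<alpha> = {}" using AR by blast
  have tasks: "tasks = {1..m} - Range \<alpha>" using pa by (simp add: partial_assignment_def)
  have "Domain ?\<beta> = Domain \<alpha> \<union> g ` tasks" by auto
  then have "partial_assignment m ?\<beta> ({1..m} - Range ?\<beta>) (N - {v. \<exists>a \<in> Domain ?\<beta>. (v, a) \<in> E\<^sup>*})"
    unfolding partial_assignment_def
  proof (intro conjI refl)
    have "g j \<in> N" if "j \<in> tasks" for j using that g(1) R(1) by blast
    then show "?\<beta> \<subseteq> N \<times> {1..m}"
      using partial_assignmentD(1)[OF pa] tasks by auto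
    show "single_valued (?\<beta>\<inverse>)"
      using partial_assignmentD(4)[OF pa] tasks by (auto simp: single_valued_def)
    have "g k \<notin> Domain \<alpha>" if "k \<in> tasks" for k using that g(1) disj by blast
    then show "single_valued ?\<beta>"
      using partial_assignmentD(5)[OF pa] inj_onD[OF g(2)] by (auto simp: single_valued_def)
    show "\<forall>a \<in> Domain ?\<beta>. \<forall>a' \<in> Domain ?\<beta>. (a, a') \<notin> E\<^sup>+"
    proof (intro ballI)
      fix a a' assume "a \<in> Domain ?\<beta>" "a' \<in> Domain ?\<beta>"
      then have "a \<in> Domain \<alpha> \<or> a \<in> ?R" "a' \<in> Domain \<alpha> \<or> a' \<in> ?R" using g(1) by auto
      moreover have "(a, a') \<notin> E\<^sup>+" if "a \<in> Domain \<alpha>" "a' \<in> Domain \<alpha>"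
        using that by (rule partial_assignmentD(6)[OF pa])
      ultimately show "(a, a') \<notin> E\<^sup>+"
        using RR AR RA by (meson trancl_into_rtrancl)
    qed
  qed
  moreover have "{1..m} - Range ?\<beta> = {}" using tasks by blast
  ultimately have "feasible_assignment T m ?\<beta>"
    by (simp only: partial_assignment_complete)
  then show ?thesis by blast
qed

section \<open>The invariant\<close>

text \<open>Only \<open>lp_feasible\<close> is kept for \<open>x\<close>, since
  \<open>\<alpha>\<close> may have grown after \<open>x\<close> was computed. The last conjunct says
  that leaving \<open>T'\<close> loses no mass of open tasks on available nodes.\<close>

definition tree_inv ::
    "nat \<Rightarrow> (nat \<times> nat) set \<Rightarrow> nat set \<Rightarrow> nat set \<Rightarrow> (nat \<Rightarrow> nat \<Rightarrow> real) \<Rightarrow> rtree \<Rightarrow> bool" where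
  "tree_inv m \<alpha> tasks nodes x T' \<longleftrightarrow>
     partial_assignment m \<alpha> tasks nodes \<and> subtree T T' \<and> rt_nodes T' \<inter> Domain \<alpha> = {} \<and>
     lp_feasible T m x \<and> (\<forall>i \<in> nodes - rt_nodes T'. \<forall>j \<in> tasks. x i j = 0)"

text \<open>An available node outside the fresh tree is below a used node, where \<open>x\<close>
  has an entry 1.\<close>

lemma tree_inv_fresh:
  assumes pa: "partial_assignment m \<alpha> tasks nodes" and x: "lp_feasible_fixing T m \<alpha> x"
  shows "tree_inv m \<alpha> tasks nodes x (delete_nodes T (Domain \<alpha>))"
proof -
  have "x i j = 0"
    if i: "i \<in> nodes - rt_nodes (delete_nodes T (Domain \<alpha>))" and j: "j \<in> tasks" for i j
  proof -
    obtain a j' where a: "(a, j') \<in> \<alpha>" "(a, i) \<in> E\<^sup>*" "i \<in> N"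
      using i partial_assignment_finite(4)[OF pa] by (auto simp: delete_nodes_simps)
    moreover have "a \<in> N" "j' \<in> {1..m}" "j \<in> {1..m}" "j \<noteq> j'"
      using j a pa by (auto simp: partial_assignment_def)
    ultimately show ?thesis
      using zero_if_comparable_to_one[of m x a j' i j] x by (auto simp: lp_feasible_fixing_def)
  qed
  moreover have "rt_nodes (delete_nodes T (Domain \<alpha>)) \<inter> Domain \<alpha> = {}"
    by (auto simp: delete_nodes_simps)
  ultimately show ?thesis
    using pa x subtree_delete_nodes[OF subtree_refl]
    by (simp add: tree_inv_def lp_feasible_fixing_def)
qed

lemma tree_inv_assign:
  assumes inv: "tree_inv m \<alpha> tasks nodes x T'" and i: "i \<in> leaves T'" "i \<in> nodes" and j: "j \<in> tasks"
  shows "tree_inv m (insert (i, j) \<alpha>) (tasks - {j}) (nodes - {i} - (root_path T' i - {i})) x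
           (delete_nodes T' {i})"
proof -
  have "i \<in> rt_nodes T'" using i(1) by (simp add: leaves_def)
  then have "partial_assignment m (insert (i, j) \<alpha>) (tasks - {j}) (nodes - {i} - (root_path T' i - {i}))"
    using partial_assignment_insert[of m \<alpha> tasks nodes T' i j] inv i(2) j
    by (auto simp: tree_inv_def)
  moreover have "rt_nodes (delete_nodes T' {i}) = rt_nodes T' - {i}"
    by (rule delete_leaves_nodes) (use i in auto)
  moreover have "subtree T (delete_nodes T' {i})"
    using inv subtree_delete_nodes by (simp add: tree_inv_def)
  ultimately show ?thesis
    using inv unfolding tree_inv_def by auto
qed

text \<open>The leaves form an antichain, so the path to \<open>i\<close> meets \<open>L\<close> in
  \<open>i\<close> alone and exactly one candidate is lost.\<close>

lemma leaves_after_assign: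
  assumes sub: "subtree T T'" and L: "L \<subseteq> leaves T'" and i: "i \<in> L"
  shows "L - {i} \<subseteq> leaves (delete_nodes T' {i})"
    and "(L - {i}) \<inter> (nodes - {i} - (root_path T' i - {i})) = L \<inter> nodes - {i}"
proof -
  have iT: "i \<in> rt_nodes T'" using L i by (auto simp: leaves_def)
  have "rt_nodes (delete_nodes T' {i}) = rt_nodes T' - {i}"
    by (rule delete_leaves_nodes) (use L i in auto)
  moreover have "rt_edges (delete_nodes T' {i}) \<subseteq> rt_edges T'" by (simp add: delete_nodes_simps)
  ultimately show "L - {i} \<subseteq> leaves (delete_nodes T' {i})"
    using L unfolding leaves_def by blast
  have "v = i" if "v \<in> L" "v \<in> root_path T' i" for v
    using that L iT root_path_subtree[OF sub iT] subtree_leaves_antichain[OF sub, of v i] by auto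
  then show "(L - {i}) \<inter> (nodes - {i} - (root_path T' i - {i})) = L \<inter> nodes - {i}" by auto
qed

lemma tree_inv_delete_leaves:
  assumes inv: "tree_inv m \<alpha> tasks nodes x T'" and L: "L \<subseteq> leaves T'"
    and zero: "\<forall>i \<in> L \<inter> nodes. \<forall>j \<in> tasks. x i j = 0"
  shows "tree_inv m \<alpha> tasks nodes x (delete_nodes T' L)"
  using inv zero subtree_delete_nodes[of T' L] delete_leaves_nodes[OF L]
  unfolding tree_inv_def by auto

text \<open>Leaves of a pruned \<open>T'\<close> may be inner nodes of \<open>T\<close>; the
  exchange argument turns them into leaves of the tree built after the next LP call.\<close>

lemma card_le_fresh_leaves:
  assumes inv: "tree_inv m \<alpha> tasks nodes x T'" and L: "L \<subseteq> leaves T'"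
  shows "card (L \<inter> nodes) \<le> card (nodes \<inter> leaves (delete_nodes T (Domain \<alpha>)))"
proof (rule antichain_card_le_leaves)
  have sub: "subtree T T'" and disj: "rt_nodes T' \<inter> Domain \<alpha> = {}"
    using inv by (auto simp: tree_inv_def)
  have LT: "L \<subseteq> rt_nodes T'" using L by (auto simp: leaves_def)
  show "partial_assignment m \<alpha> tasks nodes" using inv by (simp add: tree_inv_def)
  show "u = v" if "u \<in> L \<inter> nodes" "v \<in> L \<inter> nodes" "(u, v) \<in> E\<^sup>*" for u v
    using that L LT subtree_leaves_antichain[OF sub] by blast
  show "(a, v) \<notin> E\<^sup>*" if "a \<in> Domain \<alpha>" "v \<in> L \<inter> nodes" for a v
    using that LT disj subtree_ancestor[OF sub, of a v] by blast
qed simp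

text \<open>Double counting: each open task has mass 1 on the available nodes of \<open>T'\<close>,
  these all lie above available leaves of \<open>T'\<close>, and the path to each such leaf has mass
  at most 1.\<close>

lemma boa_continue_if_fixing:
  assumes inv: "tree_inv m \<alpha> tasks nodes x T'" and ne: "tasks \<noteq> {}"
    and fix1: "\<forall>(i, j) \<in> \<alpha>. x i j = 1"
  shows "boa_continue tasks nodes x T'"
proof -
  have pa: "partial_assignment m \<alpha> tasks nodes" and sub: "subtree T T'"
    and lp: "lp_feasible T m x" and Z: "\<And>i j. i \<in> nodes - rt_nodes T' \<Longrightarrow> j \<in> tasks \<Longrightarrow> x i j = 0"
    using inv by (auto simp: tree_inv_def)
  note fin = partial_assignment_finite[OF pa]
  have nodes: "nodes = N - {v. \<exists>a \<in> Domain \<alpha>. (v, a) \<in> E\<^sup>*}"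
    using pa by (simp add: partial_assignment_def)
  let ?M = "nodes \<inter> rt_nodes T'" and ?K = "nodes \<inter> leaves T'"
  have finMK: "finite ?M" "finite ?K" using fin by auto
  have nonneg: "0 \<le> x i j" if "i \<in> N" "j \<in> {1..m}" for i j
    using lp that by (auto simp: lp_feasible_def)
  have zero: "x i j = 0" if i: "i \<in> N - ?M" and j: "j \<in> tasks" for i j
  proof (cases "i \<in> nodes")
    case True
    then show ?thesis using i j Z by blast
  next
    case False
    then obtain a j' where a: "(a, j') \<in> \<alpha>" "(i, a) \<in> E\<^sup>*" "i \<in> N"
      using i nodes by auto
    moreover have "a \<in> N" "j' \<in> {1..m}" "j \<in> {1..m}" "j \<noteq> j'"
      using j a pa by (auto simp: partial_assignment_def)
    ultimately show ?thesis
      using zero_if_comparable_to_one[of m x a j' i j] lp fix1 by auto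
  qed
  have col: "(\<Sum>i \<in> ?M. x i j) = 1" if "j \<in> tasks" for j
  proof -
    have "(\<Sum>i \<in> ?M. x i j) = (\<Sum>i \<in> N. x i j)"
      by (rule sum.mono_neutral_left) (use fin zero that in auto)
    then show ?thesis using lp fin(3) that by (auto simp: lp_feasible_def)
  qed
  have "\<exists>i \<in> ?M. \<exists>j \<in> tasks. x i j \<noteq> 0"
    using ne col by (metis all_not_in_conv sum.neutral zero_neq_one)
  moreover have "real (card tasks) \<le> real (card ?K)"
  proof -
    have anc: "{i. (i, k) \<in> E\<^sup>*} \<subseteq> N" if "k \<in> ?K" for k
      using that fin(4) rtrancl_in_N by blast
    then have financ: "finite {i. (i, k) \<in> E\<^sup>*}" if "k \<in> ?K" for k
      using that finite_N by (metis finite_subset)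
    have "real (card tasks) = (\<Sum>j \<in> tasks. \<Sum>i \<in> ?M. x i j)" by (simp add: col)
    also have "\<dots> = (\<Sum>i \<in> ?M. \<Sum>j \<in> tasks. x i j)" by (rule sum.swap)
    also have "\<dots> \<le> (\<Sum>i \<in> ?M. \<Sum>j = 1..m. x i j)"
      by (intro sum_mono sum_mono2) (use fin nonneg in auto)
    \<comment> \<open>A node above several leaves is counted repeatedly, which only increases the
      nonnegative sum.\<close>
    also have "\<dots> \<le> (\<Sum>(k, i) \<in> (SIGMA k : ?K. {i. (i, k) \<in> E\<^sup>*}). \<Sum>j = 1..m. x i j)"
    proof (rule sum_le_included[where i = snd])
      show "finite (SIGMA k : ?K. {i. (i, k) \<in> E\<^sup>*})"
        using finMK(2) financ by (rule finite_SigmaI)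
      show "\<forall>p \<in> (SIGMA k : ?K. {i. (i, k) \<in> E\<^sup>*}). 0 \<le> (case p of (k, i) \<Rightarrow> \<Sum>j = 1..m. x i j)"
        using subsetD[OF anc] nonneg by (auto intro!: sum_nonneg)
      show "\<forall>i \<in> ?M. \<exists>p \<in> (SIGMA k : ?K. {i. (i, k) \<in> E\<^sup>*}).
          snd p = i \<and> (\<Sum>j = 1..m. x i j) \<le> (case p of (k, i) \<Rightarrow> \<Sum>j = 1..m. x i j)"
      proof
        fix i assume i: "i \<in> ?M"
        then obtain k where k: "k \<in> leaves T'" "(i, k) \<in> E\<^sup>*"
          using leaf_below[OF sub] by blast
        \<comment> \<open>If \<open>k\<close> were above a used node, so would be
          \<open>i\<close>.\<close>
        have "k \<in> nodes"
          using i k nodes rtrancl_in_N by (auto dest: rtrancl_trans)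
        then show "\<exists>p \<in> (SIGMA k : ?K. {i. (i, k) \<in> E\<^sup>*}).
          snd p = i \<and> (\<Sum>j = 1..m. x i j) \<le> (case p of (k, i) \<Rightarrow> \<Sum>j = 1..m. x i j)"
          using k by (intro bexI[of _ "(k, i)"]) auto
      qed
    qed (rule finMK(1))
    also have "\<dots> = (\<Sum>k \<in> ?K. \<Sum>i | (i, k) \<in> E\<^sup>*. \<Sum>j = 1..m. x i j)"
      by (rule sum.Sigma[symmetric]) (use finMK(2) financ in auto)
    also have "\<dots> \<le> (\<Sum>k \<in> ?K. 1)"
      by (rule sum_mono) (use path_sum_le_1[OF lp] fin(4) in blast)
    finally show ?thesis by simp
  qed
  ultimately show ?thesis by (simp add: boa_continue_def)
qed

text \<open>Before and just after the LP call, the leaves counted are those of the tree about to be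
  built. In the loop the count refers to \<open>L\<close>, because deletions can turn parents into
  new leaves of \<open>T'\<close> outside \<open>L\<close>.\<close>

fun boa_inv :: "nat \<Rightarrow> boa_state \<Rightarrow> bool" where
  "boa_inv m (Solve_LP \<alpha> tasks nodes) \<longleftrightarrow>
     partial_assignment m \<alpha> tasks nodes \<and> tasks \<noteq> {} \<and>
     card tasks \<le> card (nodes \<inter> leaves (delete_nodes T (Domain \<alpha>)))"
| "boa_inv m (Build_Tree \<alpha> tasks nodes x) \<longleftrightarrow>
     partial_assignment m \<alpha> tasks nodes \<and> tasks \<noteq> {} \<and>
     card tasks \<le> card (nodes \<inter> leaves (delete_nodes T (Domain \<alpha>))) \<and>
     lp_feasible_fixing T m \<alpha> x"
| "boa_inv m (Take_Leaves \<alpha> tasks nodes x T') \<longleftrightarrow>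
     tree_inv m \<alpha> tasks nodes x T' \<and> tasks \<noteq> {} \<and> card tasks \<le> card (nodes \<inter> leaves T')"
| "boa_inv m (Assign_Loop \<alpha> tasks nodes x T' L) \<longleftrightarrow>
     tree_inv m \<alpha> tasks nodes x T' \<and> L \<subseteq> leaves T' \<and> card tasks \<le> card (L \<inter> nodes)"
| "boa_inv m (Branch \<alpha> tasks nodes x T' L) \<longleftrightarrow>
     tree_inv m \<alpha> tasks nodes x T' \<and> L \<subseteq> leaves T' \<and> card tasks \<le> card (L \<inter> nodes) \<and>
     (\<forall>i \<in> L \<inter> nodes. \<forall>j \<in> tasks. x i j = 0)"
| "boa_inv m (Return \<alpha>) \<longleftrightarrow> feasible_assignment T m \<alpha>"

lemma boa_inv_step:
  assumes "boa_step T w m s s'" "boa_inv m s"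
  shows "boa_inv m s'"
  using assms
proof (induction rule: boa_step.induct)
  case (build_tree \<alpha> tasks nodes x)
  have "{i. \<exists>j. (i, j) \<in> \<alpha>} = Domain \<alpha>" by auto
  then show ?case using build_tree tree_inv_fresh by auto
next
  case (assign i L nodes j tasks x \<alpha> T')
  let ?nodes = "nodes - {i} - (root_path T' i - {i})"
  have inv: "tree_inv m \<alpha> tasks nodes x T'" and L: "L \<subseteq> leaves T'" and i: "i \<in> L" "i \<in> nodes"
    and card: "card tasks \<le> card (L \<inter> nodes)"
    using assign by auto
  have sub: "subtree T T'" and fin: "finite tasks" "finite nodes"
    using inv partial_assignment_finite by (auto simp: tree_inv_def)
  have "card (tasks - {j}) \<le> card (L \<inter> nodes - {i})"
    using card fin i \<open>j \<in> tasks\<close> by simp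
  then show ?case
    using tree_inv_assign[OF inv _ i(2) \<open>j \<in> tasks\<close>] leaves_after_assign[OF sub L i(1)] L i(1)
    by auto
next
  case (finish tasks \<alpha> nodes x T' L)
  then show ?case using partial_assignment_complete by (auto simp: tree_inv_def)
next
  case (go_up tasks nodes x T' L \<alpha>)
  then show ?case
    using tree_inv_delete_leaves[of m \<alpha> tasks nodes x T' L] by (auto simp: boa_continue_def)
next
  case (resolve_lp tasks nodes x T' L \<alpha>)
  then show ?case
    using card_le_fresh_leaves[of m \<alpha> tasks nodes x T' L] by (auto simp: tree_inv_def)
qed (auto simp: lp_optimal_fixing_def Int_commute)

text \<open>The nodes used by a feasible assignment are an antichain of at least \<open>m\<close>
  nodes, which the exchange argument turns into leaves of \<open>T\<close>.\<close>

lemma boa_inv_init: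
  assumes "feasible_assignment T m \<beta>" "N = {1..n}" "m \<ge> 1"
  shows "boa_inv m (boa_init n m)"
proof -
  have \<beta>: "\<beta> \<subseteq> N \<times> {1..m}" "\<forall>j \<in> {1..m}. \<exists>!i. (i, j) \<in> \<beta>"
    "\<forall>i j j'. (i, j) \<in> \<beta> \<and> (i, j') \<in> \<beta> \<longrightarrow> j = j'"
    "\<And>i i'. i \<in> Domain \<beta> \<Longrightarrow> i' \<in> Domain \<beta> \<Longrightarrow> (i, i') \<notin> E\<^sup>+"
    using assms(1) unfolding feasible_assignment_def by blast+
  have fin: "finite (Domain \<beta>)" using \<beta>(1) finite_N by (auto intro: finite_subset)
  obtain f where f: "\<And>j. j \<in> {1..m} \<Longrightarrow> (f j, j) \<in> \<beta>" using \<beta>(2) by metis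
  have "inj_on f {1..m}" using f \<beta>(3) by (metis inj_onI)
  then have "card {1..m} \<le> card (Domain \<beta>)"
    using f fin by (intro card_inj_on_le) blast+
  also have "\<dots> \<le> card (N \<inter> leaves (delete_nodes T (Domain ({} :: (nat \<times> nat) set))))"
  proof (rule antichain_card_le_leaves[OF partial_assignment_empty])
    show "u = v" if "u \<in> Domain \<beta>" "v \<in> Domain \<beta>" "(u, v) \<in> E\<^sup>*" for u v
      using that \<beta>(4) by (auto simp: rtrancl_eq_or_trancl)
  qed (use \<beta>(1) in auto)
  finally show ?thesis
    using assms(2,3) partial_assignment_empty[of m] by (simp add: boa_init_def)
qed

lemma boa_progress:
  assumes "boa_inv m s" "\<nexists>s'. boa_step T w m s s'"
  shows "\<exists>\<alpha>. s = Return \<alpha> \<and> feasible_assignment T m \<alpha>"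
proof (cases s)
  case (Solve_LP \<alpha> tasks nodes)
  have pa: "partial_assignment m \<alpha> tasks nodes"
    and card: "card tasks \<le> card (nodes \<inter> leaves (delete_nodes T (Domain \<alpha>)))"
    using assms(1) Solve_LP by auto
  obtain \<beta> where "\<alpha> \<subseteq> \<beta>" "feasible_assignment T m \<beta>"
    using partial_assignment_extends[OF pa card] by blast
  then have "lp_feasible_fixing T m \<alpha> (\<lambda>i j. of_bool ((i, j) \<in> \<beta>))"
    using lp_feasible_of_assignment by (auto simp: lp_feasible_fixing_def)
  then obtain x where "lp_optimal_fixing T w m \<alpha> x"
    using lp_optimum_exists partial_assignmentD(1)[OF pa] by blast
  then show ?thesis using assms(2) Solve_LP boa_step.solve_lp by blast
next
  case (Assign_Loop \<alpha> tasks nodes x T' L)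
  \<comment> \<open>The candidate pairs: finitely many, and at least one since otherwise
    \<open>leave_loop\<close> would apply. Hence a largest entry exists.\<close>
  define C where "C = {(i, j) \<in> (L \<inter> nodes) \<times> tasks. x i j \<noteq> 0}"
  have "partial_assignment m \<alpha> tasks nodes" using assms(1) Assign_Loop by (simp add: tree_inv_def)
  then have "finite ((L \<inter> nodes) \<times> tasks)" using partial_assignment_finite by simp
  then have fin: "finite C" by (rule finite_subset[rotated]) (auto simp: C_def)
  have "C \<noteq> {}"
    using assms(2) Assign_Loop boa_step.leave_loop[of L nodes tasks x T w m \<alpha> T']
    by (force simp: C_def)
  then obtain p where p: "p \<in> C" "\<And>q. q \<in> C \<Longrightarrow> (\<lambda>(i, j). x i j) q \<le> (\<lambda>(i, j). x i j) p"
    using fin obtains_MAX[OF fin] by (metis (lifting) Max_ge finite_imageI imageI)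
  obtain i j where ij: "p = (i, j)" by (cases p)
  have "\<forall>i' \<in> L \<inter> nodes. \<forall>j' \<in> tasks. x i' j' \<noteq> 0 \<longrightarrow> x i' j' \<le> x i j"
    using p(2) ij by (force simp: C_def)
  then show ?thesis
    using assms(2) Assign_Loop p(1) ij boa_step.assign[of i L nodes j tasks x T w m \<alpha> T']
    by (auto simp: C_def)
next
  case (Branch \<alpha> tasks nodes x T' L)
  then show ?thesis using assms(2) boa_step.finish boa_step.go_up boa_step.resolve_lp by metis
next
  case Build_Tree
  then show ?thesis using assms(2) boa_step.build_tree by blast
next
  case Take_Leaves
  then show ?thesis using assms(2) boa_step.take_leaves by blast
qed (use assms(1) in auto)

section \<open>Termination\<close>

fun tasks_left :: "boa_state \<Rightarrow> nat" where
  "tasks_left (Solve_LP \<alpha> tasks nodes) = card tasks"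
| "tasks_left (Build_Tree \<alpha> tasks nodes x) = card tasks"
| "tasks_left (Take_Leaves \<alpha> tasks nodes x T') = card tasks"
| "tasks_left (Assign_Loop \<alpha> tasks nodes x T' L) = card tasks"
| "tasks_left (Branch \<alpha> tasks nodes x T' L) = card tasks"
| "tasks_left (Return \<alpha>) = 0"

text \<open>Re-solving, of phase 2, is entered only from a stale solution and produces a fresh one.\<close>

definition staleness :: "(nat \<times> nat) set \<Rightarrow> (nat \<Rightarrow> nat \<Rightarrow> real) \<Rightarrow> nat" where
  "staleness \<alpha> x = (if \<forall>(i, j) \<in> \<alpha>. x i j = 1 then 1 else 3)"

fun phase :: "boa_state \<Rightarrow> nat" where
  "phase (Solve_LP \<alpha> tasks nodes) = 2"
| "phase (Build_Tree \<alpha> tasks nodes x) = 1"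
| "phase (Take_Leaves \<alpha> tasks nodes x T') = staleness \<alpha> x"
| "phase (Assign_Loop \<alpha> tasks nodes x T' L) = staleness \<alpha> x"
| "phase (Branch \<alpha> tasks nodes x T' L) = staleness \<alpha> x"
| "phase (Return \<alpha>) = 0"

text \<open>Taking the leaves lowers this count, and deleting them afterwards leaves it unchanged.
  The value \<open>Suc (card N)\<close> exceeds the size of any freshly built tree.\<close>

fun nodes_unvisited :: "boa_state \<Rightarrow> nat" where
  "nodes_unvisited (Take_Leaves \<alpha> tasks nodes x T') = card (rt_nodes T')"
| "nodes_unvisited (Assign_Loop \<alpha> tasks nodes x T' L) = card (rt_nodes T' - L)"
| "nodes_unvisited (Branch \<alpha> tasks nodes x T' L) = card (rt_nodes T' - L)"
| "nodes_unvisited _ = Suc (card N)"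

text \<open>Orders the steps between two visits to \<open>Take_Leaves\<close>, while the other
  components stay constant.\<close>

fun position :: "boa_state \<Rightarrow> nat" where
  "position (Assign_Loop \<alpha> tasks nodes x T' L) = 2"
| "position (Branch \<alpha> tasks nodes x T' L) = 1"
| "position _ = 0"

lemma boa_step_decreases:
  assumes "boa_step T w m s s'" "boa_inv m s"
  shows "(s', s) \<in> measures [tasks_left, phase, nodes_unvisited, position]"
  using assms
proof (induction rule: boa_step.induct)
  case (build_tree \<alpha> tasks nodes x)
  have "staleness \<alpha> x = 1"
    using build_tree by (simp add: lp_feasible_fixing_def staleness_def)
  moreover have "card (rt_nodes (delete_nodes T {i. \<exists>j. (i, j) \<in> \<alpha>})) \<le> card N"
    by (rule card_mono) (auto simp: delete_nodes_simps)
  ultimately show ?case by simp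
next
  case (take_leaves \<alpha> tasks nodes x T')
  then have inv: "tree_inv m \<alpha> tasks nodes x T'" and "tasks \<noteq> {}"
    and card: "card tasks \<le> card (nodes \<inter> leaves T')" by auto
  have "finite tasks" and fin: "finite (rt_nodes T')"
    using inv partial_assignment_finite finite_N by (auto simp: tree_inv_def subtree_def intro: finite_subset)
  \<comment> \<open>The leaf count bounds a positive number of open tasks, so there is a leaf to
    take.\<close>
  then have "card (nodes \<inter> leaves T') \<noteq> 0" using card \<open>tasks \<noteq> {}\<close> by auto
  then have "leaves T' \<noteq> {}" by auto
  then have "card (rt_nodes T' - leaves T') < card (rt_nodes T')"
    using fin by (intro psubset_card_mono) (auto simp: leaves_def)
  then show ?case by simp
next
  case (assign i L nodes j tasks x \<alpha> T')
  then have "finite tasks" using partial_assignment_finite by (auto simp: tree_inv_def)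
  then have "card (tasks - {j}) < card tasks" using \<open>j \<in> tasks\<close> by (rule card_Diff1_less)
  then show ?case by simp
next
  case (finish tasks \<alpha> nodes x T' L)
  then show ?case by (simp add: staleness_def)
next
  case (go_up tasks nodes x T' L \<alpha>)
  then have "rt_nodes (delete_nodes T' L) = rt_nodes T' - L"
    by (intro delete_leaves_nodes) auto
  then show ?case by simp
next
  case (resolve_lp tasks nodes x T' L \<alpha>)
  then have "tree_inv m \<alpha> tasks nodes x (delete_nodes T' L)"
    by (intro tree_inv_delete_leaves) auto
  \<comment> \<open>With a fresh solution the procedure would go up, so \<open>x\<close> is stale
    here and the phase drops from 3 to 2.\<close>
  then have "\<not> (\<forall>(i, j) \<in> \<alpha>. x i j = 1)"
    using boa_continue_if_fixing resolve_lp.hyps by blast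
  then show ?case by (simp add: staleness_def)
qed simp_all

end

text \<open>As runs are nondeterministic, total correctness is split in two: no run is infinite, and
  every reachable state without successor has returned a feasible assignment, which also rules out
  getting stuck at an infeasible LP.\<close>

theorem theorem2:
  fixes T :: rtree and w :: "nat \<Rightarrow> nat \<Rightarrow> real" and n m :: nat
  assumes "rooted_tree T"
    and "rt_nodes T = {1..n}"
    and "m > 1"
    and "\<forall>j \<in> {1..m}. w (rt_root T) j = 0"
    and "\<exists>\<beta>. feasible_assignment T m \<beta>"
  shows "(\<nexists>s :: nat \<Rightarrow> boa_state.
            s 0 = boa_init n m \<and> (\<forall>k. boa_step T w m (s k) (s (Suc k)))) \<and>
         (\<forall>s. (boa_step T w m)\<^sup>*\<^sup>* (boa_init n m) s \<and> (\<nexists>s'. boa_step T w m s s') \<longrightarrow>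
            (\<exists>\<alpha>. s = Return \<alpha> \<and> feasible_assignment T m \<alpha>))"
proof -
  interpret tree T using assms(1) by unfold_locales
  have init: "boa_inv m (boa_init n m)"
    using assms(2,3,5) boa_inv_init by auto
  show ?thesis
  proof (intro conjI notI allI impI)
    assume "\<exists>s :: nat \<Rightarrow> boa_state. s 0 = boa_init n m \<and> (\<forall>k. boa_step T w m (s k) (s (Suc k)))"
    then obtain s where s: "s 0 = boa_init n m" "\<And>k. boa_step T w m (s k) (s (Suc k))" by blast
    have "boa_inv m (s k)" for k
      by (induction k) (simp add: s(1) init, rule boa_inv_step[OF s(2)])
    then have "(s (Suc k), s k) \<in> measures [tasks_left, phase, nodes_unvisited, position]" for k
      using s(2) boa_step_decreases by blast
    then show False
      using wf_measures wf_iff_no_infinite_down_chain by metis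
  next
    fix s assume s: "(boa_step T w m)\<^sup>*\<^sup>* (boa_init n m) s \<and> (\<nexists>s'. boa_step T w m s s')"
    then have "(boa_step T w m)\<^sup>*\<^sup>* (boa_init n m) s" by blast
    then have "boa_inv m s"
      by (induction rule: rtranclp_induct) (use init boa_inv_step in auto)
    then show "\<exists>\<alpha>. s = Return \<alpha> \<and> feasible_assignment T m \<alpha>"
      using s boa_progress by blast
  qed
qed

end
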